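(* Let $x_1,\ldots,x_m$ be continuous, independent and identically distributed random variables in the unit ball $\Omega_n\subset\mathbb{R}^n$ with probability density function $f\in C^\infty_0(\Omega_n)$. Let $$g_m(s,\theta)=\frac{1}{m}\,\#\{i\in\{1,\ldots,m\} : x_i\cdot\theta\le s\},\qquad (s,\theta)\in Z=\mathbb{R}\times S^{n-1},$$ be the approximation to the half space Radon transform $g=R_Hf$. Let $K$ projection directions $\theta_1,\ldots,\theta_K\in S^{n-1}$ be uniformly spread over $S^{n-1}$, with associated area elements $w_1,\ldots,w_K\ge 0$ satisfying $\sum_{j=1}^K w_j=w_{1,n-1}$. Write $g_\theta(s)=g(s,\theta)$, $g_{m,\theta}(s)=g_m(s,\theta)$ and $$\epsilon(K)=\left|\,\|g-g_m\|^2_{L^2(Z)}-\sum_{j=1}^K w_j\,\|g_{\theta_j}-g_{m,\theta_j}\|^2_{L^2(\mathbb{R})}\right|.$$ Then, for any $0\le p\le 1$, with probability at least $1-p$, $$\|g-g_m\|^2_{L^2(Z)}\le w_{1,n-1}\,\frac{\log\frac{2K}{p}}{m}+\epsilon(K).$$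
   Context: $\Omega_n$ is the unit ball of $\mathbb{R}^n$; $C^\infty_0(\Omega_n)$ is the space of smooth functions compactly supported on $\Omega_n$; $S^{n-1}$ is the unit sphere of $\mathbb{R}^n$ with surface measure $\mathrm{d}\theta$, and $w_{1,n-1}$ is its total surface area. $Z=\mathbb{R}\times S^{n-1}$ is the unit cylinder, with $\|h\|^2_{L^2(Z)}=\int_{S^{n-1}}\int_{\mathbb{R}}|h(s,\theta)|^2\,\mathrm{d}s\,\mathrm{d}\theta$. The half space Radon transform is $R_Hf(s,\theta)=\int_{-\infty}^s\int_{\mathbb{R}^n}f(x)\,\delta(x\cdot\theta-r)\,\mathrm{d}x\,\mathrm{d}r$ with $\delta$ the Dirac delta, i.e. $R_Hf(s,\theta)=\int_{\{x\,:\,x\cdot\theta\le s\}}f(x)\,\mathrm{d}x$. The directions $\theta_j$ are fixed (deterministic) and are used as nodes of a Riemann sum for the integral over $S^{n-1}$ with area elements $w_j$; "uniformly spread" carries no further quantitative condition. The quantity $\epsilon(K)$ is the error in approximating the integral over $S^{n-1}$ by this Riemann sum; it depends on the sample. For $p=0$ the right-hand side is read as $+\infty$. *)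

theory Defs
  imports "HOL-Probability.Probability"
begin

text \<open>
  In finite dimension, continuity of all iterated directional derivatives of order \<open>k\<close> is
  continuity of the \<open>k\<close>-th Frechet derivative.
\<close>

primrec Ck :: "nat \<Rightarrow> ('a::euclidean_space \<Rightarrow> real) \<Rightarrow> bool" where
  "Ck 0 f \<longleftrightarrow> continuous_on UNIV f"
| "Ck (Suc k) f \<longleftrightarrow>
     (\<forall>x. f differentiable (at x)) \<and> (\<forall>v. Ck k (\<lambda>x. frechet_derivative f (at x) v))"

definition C0_infinity :: "'a::euclidean_space set \<Rightarrow> ('a \<Rightarrow> real) set" where
  "C0_infinity S =
     {f. (\<forall>k. Ck k f) \<and> compact (closure {x. f x \<noteq> 0}) \<and> closure {x. f x \<noteq> 0} \<subseteq> S}"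

text \<open>
  Surface measure on the unit sphere of an \<open>n\<close>-dimensional Euclidean space.  In polar coordinates
  \<open>dx = r ^ (n - 1) dr d\<theta>\<close>, so the surface area of a Borel set \<open>A\<close> of directions is \<open>n\<close> times the
  Lebesgue measure of the cone \<open>{r\<theta> | 0 < r < 1, \<theta> \<in> A}\<close>.  For \<open>n = 1\<close> this is counting
  measure on the two-point sphere.
\<close>

definition sphere_measure :: "'a::euclidean_space measure" where
  "sphere_measure =
     scale_measure (of_nat DIM('a))
       (distr (restrict_space lborel (ball 0 1 - {0})) (restrict_space borel (sphere 0 1)) sgn)"

definition sphere_area :: "'a::euclidean_space itself \<Rightarrow> real" where
  "sphere_area _ = measure (sphere_measure :: 'a measure) (sphere 0 1)"

lemma space_sphere_measure: "space sphere_measure = sphere 0 1"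
  by (simp add: sphere_measure_def space_scale_measure space_restrict_space)

lemma sets_sphere_measure: "sets sphere_measure = sets (restrict_space borel (sphere 0 1))"
  by (simp add: sphere_measure_def)

lemma emeasure_sphere_measure:
  fixes A :: "'a::euclidean_space set"
  assumes "A \<in> sets borel" "A \<subseteq> sphere 0 1"
  shows "emeasure sphere_measure A =
    of_nat DIM('a) * emeasure lborel {x \<in> ball 0 1 - {0}. sgn x \<in> A}"
proof -
  have meas: "sgn \<in> restrict_space lborel (ball 0 1 - {0}) \<rightarrow>\<^sub>M
      restrict_space borel (sphere (0::'a) 1)"
  proof (rule measurable_restrict_space2)
    show "sgn \<in> space (restrict_space lborel (ball 0 1 - {0})) \<rightarrow> sphere (0::'a) 1"
      by (auto simp: space_restrict_space norm_sgn)
    have "sgn \<in> borel_measurable (borel :: 'a measure)"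
      unfolding sgn_div_norm by measurable
    then show "sgn \<in> borel_measurable (restrict_space lborel (ball (0::'a) 1 - {0}))"
      by (intro measurable_restrict_space1) simp
  qed
  have "A \<in> sets (restrict_space borel (sphere 0 1))"
    using assms by (subst sets_restrict_space_iff) auto
  then have "emeasure sphere_measure A = of_nat DIM('a) *
      emeasure (restrict_space lborel (ball 0 1 - {0}))
        (sgn -` A \<inter> space (restrict_space lborel (ball (0::'a) 1 - {0})))"
    by (simp add: sphere_measure_def emeasure_distr[OF meas])
  also have "sgn -` A \<inter> space (restrict_space lborel (ball (0::'a) 1 - {0})) =
      {x \<in> ball 0 1 - {0}. sgn x \<in> A}"
    by (auto simp: space_restrict_space)
  also have "emeasure (restrict_space lborel (ball 0 1 - {0})) {x \<in> ball 0 1 - {0}. sgn x \<in> A} =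
      emeasure lborel {x \<in> ball 0 1 - {0}. sgn x \<in> A}"
    by (rule emeasure_restrict_space) auto
  finally show ?thesis .
qed

lemma emeasure_sphere_measure_sphere:
  "emeasure (sphere_measure :: 'a::euclidean_space measure) (sphere 0 1) =
     of_nat DIM('a) * emeasure lborel (ball (0::'a) 1)"
proof -
  have eq: "{x \<in> ball 0 1 - {0}. sgn x \<in> sphere 0 1} = ball (0::'a) 1 - {0}"
    by (auto simp: norm_sgn)
  have "emeasure lborel (ball (0::'a) 1 - {0}) = emeasure lborel (ball (0::'a) 1)"
    by (rule emeasure_Diff_null_set) auto
  then show ?thesis
    by (subst emeasure_sphere_measure) (simp_all only: eq borel_closed closed_sphere order.refl)
qed

definition line_L2_norm :: "(real \<Rightarrow> real) \<Rightarrow> real" where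
  "line_L2_norm u = sqrt (LINT s|lborel. \<bar>u s\<bar>\<^sup>2)"

definition cylinder_L2_norm :: "(real \<Rightarrow> 'a::euclidean_space \<Rightarrow> real) \<Rightarrow> real" where
  "cylinder_L2_norm h = sqrt (LINT \<theta>|sphere_measure. LINT s|lborel. \<bar>h s \<theta>\<bar>\<^sup>2)"

definition half_space_radon :: "('a::euclidean_space \<Rightarrow> real) \<Rightarrow> real \<Rightarrow> 'a \<Rightarrow> real" where
  "half_space_radon f s \<theta> = (LINT x:{x. x \<bullet> \<theta> \<le> s}|lborel. f x)"

text \<open>The points are \<open>x 1, \<dots>, x m\<close>.\<close>

definition empirical_radon ::
    "nat \<Rightarrow> (nat \<Rightarrow> 'a::euclidean_space) \<Rightarrow> real \<Rightarrow> 'a \<Rightarrow> real" where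
  "empirical_radon m x s \<theta> = 1 / real m * real (card {i \<in> {1..m}. x i \<bullet> \<theta> \<le> s})"

text \<open>
  The error of the Riemann sum with nodes \<open>\<theta> 1, \<dots>, \<theta> K\<close> and area elements \<open>w 1, \<dots>, w K\<close> for
  the squared norm of \<open>h\<close> on the cylinder.
\<close>

definition quadrature_error ::
    "nat \<Rightarrow> (nat \<Rightarrow> real) \<Rightarrow> (nat \<Rightarrow> 'a::euclidean_space) \<Rightarrow> (real \<Rightarrow> 'a \<Rightarrow> real) \<Rightarrow> real" where
  "quadrature_error K w \<theta> h =
     \<bar>(cylinder_L2_norm h)\<^sup>2 - (\<Sum>j=1..K. w j * (line_L2_norm (\<lambda>s. h s (\<theta> j)))\<^sup>2)\<bar>"

end

theory Submission
  imports Defs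
begin

text \<open>
  For a fixed direction \<open>\<phi>\<close> the function \<open>s \<mapsto> half_space_radon f s \<phi>\<close> is the distribution
  function \<open>F\<close> of the projections \<open>x i \<bullet> \<phi>\<close>, and \<open>s \<mapsto> empirical_radon m x s \<phi>\<close> is their
  empirical distribution function \<open>F\<^sub>m\<close>. The projections lie in \<open>[-1, 1]\<close>, so everything rests on
  a tail bound for \<open>\<integral> (F - F\<^sub>m)\<^sup>2\<close> over an interval of length \<open>2\<close>: this integral is at least
  \<open>t / m\<close> with probability at most \<open>2 exp (-t)\<close>. With \<open>t = ln (2 K / p)\<close> the bound is \<open>p / K\<close>,
  and a union over the \<open>K\<close> nodes leaves an event of probability at least \<open>1 - p\<close> on which every
  node contributes at most \<open>w j * t / m\<close> to the Riemann sum. The Riemann sum is then at most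
  the total area times \<open>t / m\<close>, and the triangle inequality adds the quadrature error.

  The one-dimensional tail bound would follow from the Dvoretzky-Kiefer-Wolfowitz inequality with
  Massart's constant, which controls \<open>sup \<bar>F - F\<^sub>m\<bar>\<close>. For the mean square a much shorter
  argument gives the same constants. Pointwise in \<open>s\<close>, Hoeffding's lemma yields
  \<open>E cosh (l m (F s - F\<^sub>m s)) \<le> exp (l\<^sup>2 m / 8)\<close>. As \<open>u \<mapsto> cosh (sqrt u)\<close> is convex, Jensen's
  inequality in \<open>s\<close> transfers this to the root mean square of \<open>F - F\<^sub>m\<close> over the interval, and
  Markov's inequality with a suitable \<open>l\<close> gives \<open>exp t / cosh (2 t) \<le> 2 exp (-t)\<close>
  (lemma \<open>prob_L2_dist_empirical_cdf_ge\<close>).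

  The claim speaks of the probability of an event that involves an integral over the cylinder.
  This event is measurable because the integrand is jointly measurable in the sample point and
  the cylinder coordinates and the surface measure is finite.
\<close>

section \<open>The hyperbolic cosine as a convex function of the square\<close>

text \<open>
  The chord of the convex function \<open>sinh\<close> from \<open>0\<close> to \<open>y\<close> lies above the graph. Read the other way,
  \<open>sinh x / x\<close> increases.
\<close>
lemma sinh_le_chord:
  fixes x y :: real
  assumes "0 \<le> x" "x \<le> y" "0 < y"
  shows "sinh x \<le> x / y * sinh y"
proof -
  have "convex_on {0..} (sinh :: real \<Rightarrow> real)"
    by (rule convex_on_realI[where f' = cosh])
       (auto intro!: derivative_eq_intros simp: cosh_real_nonneg_le_iff)
  from convex_onD[OF this, of "x / y" 0 y] show ?thesis
    using assms by simp
qed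

text \<open>
  The right-hand side, as a function of \<open>u = a\<^sup>2\<close>, is the convex function \<open>cosh (sqrt u)\<close>; the
  left-hand side is its tangent at \<open>u = b\<^sup>2\<close>. Integrating such a tangent bound is Jensen's
  inequality. The right-hand side minus the left has derivative \<open>sinh a - a / b * sinh b\<close>, which
  for \<open>a \<ge> 0\<close>, by the chord bound, changes sign from minus to plus at \<open>a = b\<close>.
\<close>
lemma cosh_ge_tangent_in_square:
  fixes a b :: real
  assumes "0 < b"
  shows "cosh b + sinh b / (2 * b) * (a\<^sup>2 - b\<^sup>2) \<le> cosh a"
proof -
  define u where "u = \<bar>a\<bar>"
  define \<psi> where "\<psi> = (\<lambda>x::real. cosh x - sinh b / (2 * b) * x\<^sup>2)"
  have deriv: "(\<psi> has_real_derivative (sinh x - x / b * sinh b)) (at x)" for x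
    unfolding \<psi>_def using assms
    by (auto intro!: derivative_eq_intros simp: field_simps)
  have "\<psi> b \<le> \<psi> u"
  proof (cases "b \<le> u")
    case True
    show ?thesis
    proof (rule DERIV_nonneg_imp_nondecreasing[OF True])
      fix x assume "b \<le> x" "x \<le> u"
      then have "0 \<le> sinh x - x / b * sinh b"
        using sinh_le_chord[of b x] assms by (simp add: field_simps)
      then show "\<exists>y. (\<psi> has_real_derivative y) (at x) \<and> 0 \<le> y"
        using deriv by blast
    qed
  next
    case False
    then have "u \<le> b" by simp
    then show ?thesis
    proof (rule DERIV_nonpos_imp_nonincreasing)
      fix x assume "u \<le> x" "x \<le> b"
      then have "sinh x - x / b * sinh b \<le> 0"
        using sinh_le_chord[of x b] assms by (simp add: u_def)
      then show "\<exists>y. (\<psi> has_real_derivative y) (at x) \<and> y \<le> 0"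
        using deriv by blast
    qed
  qed
  moreover have "cosh u = cosh a" "u\<^sup>2 = a\<^sup>2"
    by (auto simp: u_def abs_if)
  ultimately show ?thesis
    by (simp add: \<psi>_def algebra_simps)
qed

section \<open>Exponential moments of sums of bounded variables\<close>

context indep_interval_bounded_random_variables
begin

text \<open>
  Independence turns the exponential moment into a product, and Hoeffding's lemma bounds each factor.
\<close>
lemma nn_integral_exp_centred_sum_le:
  assumes "0 < l"
  shows "(\<integral>\<^sup>+x. exp (l * (\<Sum>i\<in>I. X i x - expectation (X i))) \<partial>M)
    \<le> ennreal (exp (l\<^sup>2 * (\<Sum>i\<in>I. (b i - a i)\<^sup>2) / 8))"
proof -
  have "(\<integral>\<^sup>+x. exp (l * (\<Sum>i\<in>I. X i x - expectation (X i))) \<partial>M)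
      = (\<integral>\<^sup>+x. (\<Prod>i\<in>I. ennreal (exp (l * (X i x - expectation (X i))))) \<partial>M)"
    by (simp add: sum_distrib_left exp_sum fin prod_ennreal)
  also have "\<dots> = (\<Prod>i\<in>I. \<integral>\<^sup>+x. ennreal (exp (l * (X i x - expectation (X i)))) \<partial>M)"
    by (intro indep_vars_nn_integral fin indep_vars_compose2[OF indep]) auto
  also have "\<dots> \<le> (\<Prod>i\<in>I. ennreal (exp (l\<^sup>2 * (b i - a i)\<^sup>2 / 8)))"
  proof (intro prod_mono_ennreal)
    fix i assume i: "i \<in> I"
    from i interpret interval_bounded_random_variable M "X i" "a i" "b i" ..
    show "(\<integral>\<^sup>+x. ennreal (exp (l * (X i x - expectation (X i)))) \<partial>M)
        \<le> ennreal (exp (l\<^sup>2 * (b i - a i)\<^sup>2 / 8))"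
      by (rule Hoeffdings_lemma_nn_integral) fact
  qed
  also have "\<dots> = ennreal (exp (l\<^sup>2 * (\<Sum>i\<in>I. (b i - a i)\<^sup>2) / 8))"
    by (simp add: prod_ennreal sum_distrib_left sum_divide_distrib exp_sum fin)
  finally show ?thesis .
qed

text \<open>
  The two-sided form: \<open>cosh\<close> averages the exponential moments of the sum and of its negative, and
  the negated variables range over intervals of the same lengths.
\<close>
lemma nn_integral_cosh_centred_sum_le:
  assumes "0 < l"
  shows "(\<integral>\<^sup>+x. cosh (l * (\<Sum>i\<in>I. X i x - expectation (X i))) \<partial>M)
    \<le> ennreal (exp (l\<^sup>2 * (\<Sum>i\<in>I. (b i - a i)\<^sup>2) / 8))"
proof -
  interpret flip: indep_interval_bounded_random_variables M I "\<lambda>i x. - X i x" "\<lambda>i. - b i" "\<lambda>i. - a i"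
  proof unfold_locales
    fix i assume "i \<in> I"
    then show "AE x in M. - X i x \<in> {- b i..- a i}"
      by (intro eventually_mono[OF AE_in_interval]) auto
  qed (auto simp: fin intro: indep_vars_compose2[OF indep])
  define S where "S x = (\<Sum>i\<in>I. X i x - expectation (X i))" for x
  define B where "B = exp (l\<^sup>2 * (\<Sum>i\<in>I. (b i - a i)\<^sup>2) / 8)"
  have [measurable]: "S \<in> borel_measurable M"
    unfolding S_def by measurable
  have neg: "(\<Sum>i\<in>I. - X i x - expectation (\<lambda>x. - X i x)) = - S x" for x
    by (simp add: S_def sum_negf sum_subtractf)
  define c :: real where "c = 1 / 2"
  have c: "0 \<le> c" "c + c = 1"
    by (simp_all add: c_def)
  have half: "cosh y = c * exp y + c * exp (- y)" for y :: real
    by (simp add: cosh_field_def c_def)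
  have "(\<integral>\<^sup>+x. cosh (l * S x) \<partial>M)
      = (\<integral>\<^sup>+x. ennreal c * ennreal (exp (l * S x)) + ennreal c * ennreal (exp (l * - S x)) \<partial>M)"
    using c by (intro nn_integral_cong) (simp add: half ennreal_mult)
  also have "\<dots> = ennreal c * (\<integral>\<^sup>+x. exp (l * S x) \<partial>M)
      + ennreal c * (\<integral>\<^sup>+x. exp (l * - S x) \<partial>M)"
    by (simp add: nn_integral_add nn_integral_cmult)
  also have "\<dots> \<le> ennreal c * ennreal B + ennreal c * ennreal B"
    using nn_integral_exp_centred_sum_le[OF assms] flip.nn_integral_exp_centred_sum_le[OF assms]
    unfolding neg by (intro add_mono mult_left_mono) (auto simp: S_def B_def power2_commute)
  also have "\<dots> = ennreal B"
    using c by (simp add: B_def flip: ennreal_mult ennreal_plus distrib_right)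
  finally show ?thesis
    by (simp add: S_def B_def)
qed

end

section \<open>Mean square deviation of an empirical distribution function\<close>

text \<open>
  The constant \<open>2\<close> and the rate are those of the Dvoretzky-Kiefer-Wolfowitz inequality for the
  larger quantity \<open>(b - a) * (sup \<bar>F - F\<^sub>n\<bar>)\<^sup>2\<close>, where \<open>n\<close> is the sample size. The rate cannot be
  improved: for the uniform law on \<open>{a, b}\<close> and large \<open>n\<close> the integral is distributed nearly as
  \<open>(b - a) / (4 n)\<close> times the square of a standard normal variable. Measurability is part of the
  conclusion, for \<open>prob\<close> of a set that is not an event carries no information.
\<close>
lemma (in prob_space) prob_L2_dist_empirical_cdf_ge:
  fixes Y :: "'i \<Rightarrow> 'a \<Rightarrow> real" and F :: "real \<Rightarrow> real" and I :: "'i set"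
  defines "V \<equiv> \<lambda>\<omega>. LINT s|lborel. (F s - real (card {i\<in>I. Y i \<omega> \<le> s}) / real (card I))\<^sup>2"
  assumes fin: "finite I" and ne: "I \<noteq> {}"
    and indep: "indep_vars (\<lambda>_. borel) Y I"
    and range: "\<And>i \<omega>. i \<in> I \<Longrightarrow> \<omega> \<in> space M \<Longrightarrow> Y i \<omega> \<in> {a..b}"
    and F: "\<And>i s. i \<in> I \<Longrightarrow> prob {\<omega> \<in> space M. Y i \<omega> \<le> s} = F s"
    and ab: "a < b" and t: "0 < t"
  shows "V \<in> borel_measurable M"
    and "prob {\<omega> \<in> space M. (b - a) * t / (2 * real (card I)) \<le> V \<omega>} \<le> 2 * exp (- t)"
proof -
  define m where "m = real (card I)"
  have m: "0 < m"
    using fin ne by (simp add: m_def card_gt_0_iff)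
  obtain i0 where i0: "i0 \<in> I"
    using ne by blast
  have Y[measurable]: "\<And>i. i \<in> I \<Longrightarrow> Y i \<in> borel_measurable M"
    using indep unfolding indep_vars_def by auto
  have "mono F"
    unfolding F[OF i0, symmetric] by (intro monoI finite_measure_mono) (use i0 in auto)
  then have F_meas[measurable]: "F \<in> borel_measurable borel"
    by (rule borel_measurable_mono)
  have F01: "0 \<le> F s" "F s \<le> 1" for s
    unfolding F[OF i0, symmetric] by auto

  \<comment> \<open>The deviation. With indicators in place of the cardinality it is a multiple of a centred sum of
     independent variables, and its joint measurability is visible.\<close>
  define D where "D \<omega> s = F s - (\<Sum>i\<in>I. indicator {..s} (Y i \<omega>)) / m" for \<omega> s
  have card_eq: "real (card {i\<in>I. Y i \<omega> \<le> s}) = (\<Sum>i\<in>I. indicator {..s} (Y i \<omega>))" for \<omega> s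
    using fin by (simp add: indicator_def sum.If_cases Int_def)
  have V: "V \<omega> = (LINT s|lborel. (D \<omega> s)\<^sup>2)" for \<omega>
    by (simp add: V_def D_def card_eq m_def)
  have D_meas[measurable]: "(\<lambda>z. D (fst z) (snd z)) \<in> borel_measurable (M \<Otimes>\<^sub>M lborel)"
    unfolding D_def indicator_def atMost_iff by measurable
  have D_meas1[measurable]: "(\<lambda>s. D \<omega> s) \<in> borel_measurable borel" for \<omega>
    unfolding D_def indicator_def atMost_iff by measurable
  show V_meas[measurable]: "V \<in> borel_measurable M"
    unfolding V by measurable

  have D_bound: "\<bar>D \<omega> s\<bar> \<le> 1" for \<omega> s
  proof -
    have "(\<Sum>i\<in>I. indicator {..s} (Y i \<omega>)) \<le> (\<Sum>i\<in>I. 1::real)"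
      by (intro sum_mono) (auto simp: indicator_def)
    then have "(\<Sum>i\<in>I. indicator {..s} (Y i \<omega>)) / m \<in> {0..1}"
      using m by (auto simp: m_def intro!: sum_nonneg divide_nonneg_nonneg)
    then show ?thesis
      using F01[of s] by (auto simp: D_def)
  qed
  have D_zero: "D \<omega> s = 0" if "\<omega> \<in> space M" "s \<notin> {a..b}" for \<omega> s
  proof (cases "s < a")
    case True
    then have "{\<omega> \<in> space M. Y i0 \<omega> \<le> s} = {}" "\<And>i. i \<in> I \<Longrightarrow> indicator {..s} (Y i \<omega>) = (0::real)"
      using range i0 that by (force simp: indicator_def)+
    moreover from this have "F s = prob {}"
      by (simp only: F[OF i0, symmetric])
    ultimately show ?thesis
      by (simp add: D_def)
  next
    case False
    then have "{\<omega> \<in> space M. Y i0 \<omega> \<le> s} = space M" "\<And>i. i \<in> I \<Longrightarrow> indicator {..s} (Y i \<omega>) = (1::real)"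
      using range i0 that by (force simp: indicator_def)+
    moreover from this have "F s = prob (space M)"
      by (simp only: F[OF i0, symmetric])
    ultimately show ?thesis
      using m by (simp add: D_def m_def prob_space)
  qed

  \<comment> \<open>For the critical root mean square deviation \<open>r = sqrt (t / (2 * m))\<close> this is the minimiser of
     \<open>l\<^sup>2 * m / 8 - l * m * r\<close>; with it \<open>l\<^sup>2 * m / 8 = t\<close>, and \<open>cosh\<close> gets the argument
     \<open>l * m * r = 2 * t\<close>.\<close>
  define l where "l = 4 * sqrt (t / (2 * m))"
  have l: "0 < l" and l2: "l\<^sup>2 = 8 * t / m"
    using t m by (auto simp: l_def power_mult_distrib)
  define C where "C \<omega> s = cosh (l * m * D \<omega> s)" for \<omega> s
  have cosh_meas[measurable]: "(cosh :: real \<Rightarrow> real) \<in> borel_measurable borel"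
    by (intro borel_measurable_continuous_onI continuous_intros)
  have C_meas[measurable]: "(\<lambda>z. C (fst z) (snd z)) \<in> borel_measurable (M \<Otimes>\<^sub>M lborel)"
    unfolding C_def by measurable
  have C_meas2[measurable]: "(\<lambda>\<omega>. C \<omega> s) \<in> borel_measurable M" for s
    unfolding C_def D_def indicator_def atMost_iff by measurable
  have C_meas1[measurable]: "(\<lambda>s. C \<omega> s) \<in> borel_measurable borel" for \<omega>
    unfolding C_def by measurable
  have C_bound: "\<bar>C \<omega> s\<bar> \<le> cosh (l * m)" for \<omega> s
  proof -
    have "\<bar>l * m * D \<omega> s\<bar> \<le> l * m"
      using D_bound[of \<omega> s] l m by (simp add: abs_mult mult_le_cancel_left1)
    then have "cosh \<bar>l * m * D \<omega> s\<bar> \<le> cosh (l * m)"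
      by (subst cosh_real_nonneg_le_iff) auto
    moreover have "cosh \<bar>l * m * D \<omega> s\<bar> = cosh (l * m * D \<omega> s)"
      by (simp add: abs_if)
    ultimately show ?thesis
      by (simp add: C_def)
  qed

  define N where "N \<omega> = (\<integral>\<^sup>+s. ennreal (C \<omega> s) * indicator {a..b} s \<partial>lborel)" for \<omega>

  \<comment> \<open>Jensen's inequality in \<open>s\<close>, for the normalised Lebesgue measure on \<open>{a..b}\<close> and the convex
     function \<open>cosh (sqrt u)\<close>: the tangent at \<open>u = (2 * t)\<^sup>2\<close> is integrated.\<close>
  have N_ge: "ennreal ((b - a) * cosh (2 * t)) \<le> N \<omega>"
    if \<omega>: "\<omega> \<in> space M" and bad: "(b - a) * t / (2 * m) \<le> V \<omega>" for \<omega>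
  proof -
    define \<kappa> where "\<kappa> = sinh (2 * t) / (2 * (2 * t))"
    have \<kappa>: "0 \<le> \<kappa>"
      using t by (simp add: \<kappa>_def)
    have bdd: "set_integrable lborel {a..b} u"
      if "u \<in> borel_measurable borel" "\<And>s. \<bar>u s\<bar> \<le> d" for u and d :: real
      unfolding set_integrable_def
      by (rule integrableI_bounded_set_indicator[where B = d]) (use that ab in auto)
    have int_D: "set_integrable lborel {a..b} (\<lambda>s. (D \<omega> s)\<^sup>2)"
      by (rule bdd[of _ 1]) (use D_bound[of \<omega>] in \<open>auto simp: abs_square_le_1\<close>)
    have int_C: "set_integrable lborel {a..b} (C \<omega>)"
      by (rule bdd[OF _ C_bound]) simp
    have int_const: "set_integrable lborel {a..b} (\<lambda>s. c)" for c :: real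
      by (rule bdd[of _ "\<bar>c\<bar>"]) auto
    note int = int_D int_C int_const
    have VD: "V \<omega> = (LINT s:{a..b}|lborel. (D \<omega> s)\<^sup>2)"
      unfolding V set_lebesgue_integral_def
      using D_zero[OF \<omega>] by (intro Bochner_Integration.integral_cong) (auto simp: indicator_def)
    have sq: "4 * t\<^sup>2 * (b - a) \<le> l\<^sup>2 * m\<^sup>2 * V \<omega>"
    proof -
      have "4 * t\<^sup>2 * (b - a) = l\<^sup>2 * m\<^sup>2 * ((b - a) * t / (2 * m))"
        unfolding l2 using m by (simp add: power2_eq_square field_simps)
      also have "\<dots> \<le> l\<^sup>2 * m\<^sup>2 * V \<omega>"
        by (intro mult_left_mono bad) simp
      finally show ?thesis .
    qed
    have "(b - a) * cosh (2 * t)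
        \<le> (cosh (2 * t) - \<kappa> * (2 * t)\<^sup>2) * (b - a) + \<kappa> * (l * m)\<^sup>2 * V \<omega>"
      using mult_left_mono[OF sq \<kappa>] by (simp add: algebra_simps power_mult_distrib)
    also have "\<dots> = (LINT s:{a..b}|lborel. (cosh (2 * t) - \<kappa> * (2 * t)\<^sup>2) + \<kappa> * (l * m)\<^sup>2 * (D \<omega> s)\<^sup>2)"
      using ab int by (subst set_integral_add) (auto simp: VD set_lebesgue_integral_def)
    also have "\<dots> \<le> (LINT s:{a..b}|lborel. C \<omega> s)"
    proof (rule set_integral_mono)
      fix s
      show "(cosh (2 * t) - \<kappa> * (2 * t)\<^sup>2) + \<kappa> * (l * m)\<^sup>2 * (D \<omega> s)\<^sup>2 \<le> C \<omega> s"
        using cosh_ge_tangent_in_square[of "2 * t" "l * m * D \<omega> s"] t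
        by (simp add: \<kappa>_def C_def power_mult_distrib algebra_simps)
    qed (use int in auto)
    finally have "ennreal ((b - a) * cosh (2 * t)) \<le> ennreal (LINT s:{a..b}|lborel. C \<omega> s)"
      by (rule ennreal_leI)
    also have "\<dots> = (\<integral>\<^sup>+s. ennreal (indicator {a..b} s * C \<omega> s) \<partial>lborel)"
      using int_C unfolding set_integrable_def set_lebesgue_integral_def real_scaleR_def
      by (intro nn_integral_eq_integral[symmetric]) (auto simp: C_def)
    also have "\<dots> = N \<omega>"
      unfolding N_def by (intro nn_integral_cong) (auto simp: indicator_def)
    finally show ?thesis .
  qed

  \<comment> \<open>Each summand \<open>- indicator {..s} (Y i \<omega>)\<close> ranges over \<open>{-1..0}\<close>, an interval of length one,
     whence the exponent \<open>l\<^sup>2 * m / 8 = t\<close>.\<close>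
  have EC: "(\<integral>\<^sup>+\<omega>. C \<omega> s \<partial>M) \<le> ennreal (exp t)" for s
  proof -
    interpret Z: indep_interval_bounded_random_variables M I "\<lambda>i \<omega>. - indicator {..s} (Y i \<omega>)"
        "\<lambda>_. -1" "\<lambda>_. 0"
    proof unfold_locales
      show "indep_vars (\<lambda>_. borel) (\<lambda>i \<omega>. - indicator {..s} (Y i \<omega>) :: real) I"
        by (rule indep_vars_compose2[OF indep]) auto
    qed (auto simp: fin indicator_def)
    have "expectation (\<lambda>\<omega>. indicator {..s} (Y i \<omega>)) = F s" if "i \<in> I" for i
    proof -
      have "expectation (\<lambda>\<omega>. indicator {..s} (Y i \<omega>) :: real) = expectation (indicator {\<omega> \<in> space M. Y i \<omega> \<le> s})"
        by (intro Bochner_Integration.integral_cong) (auto simp: indicator_def)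
      then show ?thesis
        using F[OF that, of s] that by simp
    qed
    then have "(\<Sum>i\<in>I. - indicator {..s} (Y i \<omega>) - expectation (\<lambda>\<omega>. - indicator {..s} (Y i \<omega>)))
        = m * D \<omega> s" for \<omega>
      using m by (simp add: D_def sum_subtractf sum_negf m_def algebra_simps)
    then show ?thesis
      using Z.nn_integral_cosh_centred_sum_le[OF l] m
      by (simp add: C_def l2 mult.assoc flip: m_def)
  qed

  have N_meas[measurable]: "N \<in> borel_measurable M"
    unfolding N_def by measurable
  interpret pair_sigma_finite M lborel ..
  have "(\<integral>\<^sup>+\<omega>. N \<omega> \<partial>M) = (\<integral>\<^sup>+s. (\<integral>\<^sup>+\<omega>. ennreal (C \<omega> s) * indicator {a..b} s \<partial>M) \<partial>lborel)"
    unfolding N_def by (rule Fubini'[symmetric]) measurable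
  also have "\<dots> = (\<integral>\<^sup>+s. (\<integral>\<^sup>+\<omega>. ennreal (C \<omega> s) \<partial>M) * indicator {a..b} s \<partial>lborel)"
    by (intro nn_integral_cong nn_integral_multc) measurable
  also have "\<dots> \<le> (\<integral>\<^sup>+s. ennreal (exp t) * indicator {a..b} s \<partial>lborel)"
    by (intro nn_integral_mono mult_right_mono EC) auto
  also have "\<dots> = ennreal ((b - a) * exp t)"
    using ab by (simp add: nn_integral_cmult mult.commute flip: ennreal_mult)
  finally have EN: "(\<integral>\<^sup>+\<omega>. N \<omega> \<partial>M) \<le> ennreal ((b - a) * exp t)" .

  define c where "c = (b - a) * cosh (2 * t)"
  have c: "0 < c"
    using ab by (simp add: c_def)
  have "emeasure M {\<omega> \<in> space M. (b - a) * t / (2 * m) \<le> V \<omega>}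
      \<le> emeasure M {\<omega> \<in> space M. 1 \<le> ennreal (1 / c) * N \<omega>}"
  proof (intro emeasure_mono subsetI)
    fix \<omega> assume "\<omega> \<in> {\<omega> \<in> space M. (b - a) * t / (2 * m) \<le> V \<omega>}"
    then have "\<omega> \<in> space M" "ennreal (1 / c) * ennreal c \<le> ennreal (1 / c) * N \<omega>"
      using N_ge by (auto simp: c_def intro: mult_left_mono)
    then show "\<omega> \<in> {\<omega> \<in> space M. 1 \<le> ennreal (1 / c) * N \<omega>}"
      using c by (simp flip: ennreal_mult)
  qed measurable
  also have "\<dots> \<le> ennreal (1 / c) * (\<integral>\<^sup>+\<omega>. N \<omega> * indicator (space M) \<omega> \<partial>M)"
    using nn_integral_Markov_inequality[of N "space M" M "ennreal (1 / c)"] by simp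
  also have "\<dots> = ennreal (1 / c) * (\<integral>\<^sup>+\<omega>. N \<omega> \<partial>M)"
    by (intro arg_cong2[where f = "(*)"] nn_integral_cong) auto
  also have "\<dots> \<le> ennreal (1 / c) * ennreal ((b - a) * exp t)"
    by (intro mult_left_mono EN) simp
  also have "\<dots> = ennreal (exp t / cosh (2 * t))"
    using ab by (simp add: c_def flip: ennreal_mult)
  also have "exp t / cosh (2 * t) \<le> 2 * exp (- t)"
  proof -
    have "exp t = exp (- t) * exp (2 * t)"
      by (simp flip: exp_add)
    also have "\<dots> \<le> exp (- t) * (2 * cosh (2 * t))"
      by (intro mult_left_mono) (auto simp: cosh_field_def)
    finally show ?thesis
      by (simp add: pos_divide_le_eq mult_ac)
  qed
  finally show "prob {\<omega> \<in> space M. (b - a) * t / (2 * real (card I)) \<le> V \<omega>} \<le> 2 * exp (- t)"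
    by (simp add: m_def emeasure_eq_measure ennreal_leI)
qed

section \<open>The Radon transform and measurability on the cylinder\<close>

lemma (in prob_space) half_space_radon_eq_prob:
  assumes X: "distributed M lborel X (\<lambda>y. ennreal (f y))" and f: "\<And>y. 0 \<le> f y"
  shows "half_space_radon f s \<theta> = prob {\<omega> \<in> space M. X \<omega> \<bullet> \<theta> \<le> s}"
proof -
  have [measurable]: "X \<in> borel_measurable M"
    using distributed_measurable[OF X] by simp
  have "half_space_radon f s \<theta> = (LINT x|lborel. f x * indicator {x. x \<bullet> \<theta> \<le> s} x)"
    by (simp add: half_space_radon_def set_lebesgue_integral_def mult.commute)
  also have "\<dots> = expectation (\<lambda>\<omega>. indicator {x. x \<bullet> \<theta> \<le> s} (X \<omega>))"
    using f by (intro distributed_integral[OF X]) auto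
  also have "\<dots> = expectation (indicator {\<omega> \<in> space M. X \<omega> \<bullet> \<theta> \<le> s})"
    by (intro Bochner_Integration.integral_cong) (auto simp: indicator_def)
  finally show ?thesis
    by simp
qed

lemma half_space_radon_measurable:
  fixes f :: "'a::euclidean_space \<Rightarrow> real"
  assumes [measurable]: "f \<in> borel_measurable borel"
  shows "(\<lambda>z. half_space_radon f (fst z) (snd z)) \<in> borel_measurable (borel \<Otimes>\<^sub>M borel)"
proof -
  have eq: "indicator {x. x \<bullet> snd z \<le> fst z} x *\<^sub>R f x = (if x \<bullet> snd z \<le> fst z then f x else 0)"
    for z :: "real \<times> 'a" and x
    by simp
  show ?thesis
    unfolding half_space_radon_def set_lebesgue_integral_def eq by measurable
qed

lemma empirical_radon_measurable:
  fixes X :: "nat \<Rightarrow> 'w \<Rightarrow> 'a::euclidean_space"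
  assumes [measurable]: "\<And>i. i \<in> {1..m} \<Longrightarrow> X i \<in> borel_measurable M"
  shows "(\<lambda>z. empirical_radon m (\<lambda>i. X i (fst z)) (fst (snd z)) (snd (snd z)))
    \<in> borel_measurable (M \<Otimes>\<^sub>M (borel \<Otimes>\<^sub>M borel))"
proof -
  have eq: "empirical_radon m x s \<phi> = 1 / real m * (\<Sum>i\<in>{1..m}. if x i \<bullet> \<phi> \<le> s then 1 else 0)"
    for x s and \<phi> :: 'a
    by (simp add: empirical_radon_def sum.If_cases Int_def)
  show ?thesis
    unfolding eq by measurable
qed

lemma finite_measure_sphere_measure: "finite_measure (sphere_measure :: 'a::euclidean_space measure)"
proof (rule finite_measureI)
  have "emeasure lborel (ball (0::'a) 1) < \<infinity>"
    by (intro emeasure_bounded_finite) simp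
  then show "emeasure (sphere_measure :: 'a measure) (space sphere_measure) \<noteq> \<infinity>"
    by (simp add: space_sphere_measure emeasure_sphere_measure_sphere ennreal_mult_eq_top_iff)
qed

text \<open>
  The hypothesis uses the Borel sets of the whole space of directions, where joint measurability is
  easily checked; it restricts to the sphere. Finiteness of the surface measure is what allows the
  integral over the sphere to depend measurably on \<open>\<omega>\<close>.
\<close>
lemma cylinder_L2_norm_measurable:
  fixes h :: "'w \<Rightarrow> real \<Rightarrow> 'a::euclidean_space \<Rightarrow> real"
  assumes "(\<lambda>z. h (fst z) (fst (snd z)) (snd (snd z))) \<in> borel_measurable (M \<Otimes>\<^sub>M (borel \<Otimes>\<^sub>M borel))"
  shows "(\<lambda>\<omega>. cylinder_L2_norm (h \<omega>)) \<in> borel_measurable M"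
proof -
  interpret S: finite_measure "sphere_measure :: 'a measure"
    by (rule finite_measure_sphere_measure)
  have id: "(\<lambda>\<phi>. \<phi>) \<in> measurable (sphere_measure :: 'a measure) borel"
    unfolding measurable_cong_sets[OF sets_sphere_measure refl]
    by (intro measurable_restrict_space1) simp
  have "(\<lambda>z. (fst (fst z), snd z, snd (fst z)))
      \<in> measurable ((M \<Otimes>\<^sub>M (sphere_measure :: 'a measure)) \<Otimes>\<^sub>M lborel) (M \<Otimes>\<^sub>M (borel \<Otimes>\<^sub>M borel))"
    using id by measurable
  from measurable_compose[OF this assms]
  have [measurable]: "(\<lambda>z. h (fst (fst z)) (snd z) (snd (fst z)))
      \<in> borel_measurable ((M \<Otimes>\<^sub>M (sphere_measure :: 'a measure)) \<Otimes>\<^sub>M lborel)"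
    by simp
  have [measurable]: "(\<lambda>z. LINT s|lborel. \<bar>h (fst z) s (snd z)\<bar>\<^sup>2)
      \<in> borel_measurable (M \<Otimes>\<^sub>M (sphere_measure :: 'a measure))"
    by measurable
  have "(\<lambda>\<omega>. LINT \<phi>|sphere_measure. LINT s|lborel. \<bar>h \<omega> s \<phi>\<bar>\<^sup>2) \<in> borel_measurable M"
    by (intro S.borel_measurable_lebesgue_integral) (simp add: case_prod_beta)
  then show ?thesis
    unfolding cylinder_L2_norm_def by measurable
qed

lemma line_L2_norm_power2: "(line_L2_norm u)\<^sup>2 = (LINT s|lborel. (u s)\<^sup>2)"
  by (simp add: line_L2_norm_def)

section \<open>The deviation bound on the cylinder\<close>

theorem theorem6p1:
  fixes M :: "'w measure"
    and X :: "nat \<Rightarrow> 'w \<Rightarrow> real ^ 'n"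
    and f :: "real ^ 'n \<Rightarrow> real"
    and \<theta> :: "nat \<Rightarrow> real ^ 'n"
    and w :: "nat \<Rightarrow> real"
    and m K :: nat
    and p :: real
  assumes "prob_space M"
    and "m \<ge> 1"
    and "f \<in> C0_infinity (ball 0 1)"
    and "\<And>y. 0 \<le> f y"
    and "\<And>i \<omega>. i \<in> {1..m} \<Longrightarrow> \<omega> \<in> space M \<Longrightarrow> X i \<omega> \<in> ball 0 1"
    and "\<And>i. i \<in> {1..m} \<Longrightarrow> distributed M lborel (X i) (\<lambda>y. ennreal (f y))"
    and "prob_space.indep_vars M (\<lambda>_. borel) X {1..m}"
    and "K \<ge> 1"
    and "\<And>j. j \<in> {1..K} \<Longrightarrow> \<theta> j \<in> sphere 0 1"
    and "\<And>j. j \<in> {1..K} \<Longrightarrow> 0 \<le> w j"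
    and "(\<Sum>j=1..K. w j) = sphere_area TYPE(real ^ 'n)"
    and "0 \<le> p" and "p \<le> 1"
  defines "h \<equiv> \<lambda>\<omega> s \<phi>. half_space_radon f s \<phi> - empirical_radon m (\<lambda>i. X i \<omega>) s \<phi>"
  shows "measure M {\<omega> \<in> space M.
           ereal ((cylinder_L2_norm (h \<omega>))\<^sup>2) \<le>
             (if p = 0 then \<infinity>
              else ereal (sphere_area TYPE(real ^ 'n) * (ln (2 * real K / p) / real m)
                     + quadrature_error K w \<theta> (h \<omega>)))} \<ge> 1 - p"
proof (cases "p = 0")
  case True
  then show ?thesis
    using prob_space.prob_space[OF assms(1)] by simp
next
  case False
  interpret prob_space M by fact
  have p: "0 < p"
    using False assms(12) by simp
  define A where "A = sphere_area TYPE(real ^ 'n)"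
  define t where "t = ln (2 * real K / p)"
  have "1 < 2 * real K / p"
    using p assms(8,13) by (simp add: pos_less_divide_eq)
  then have t: "0 < t"
    by (simp add: t_def)
  have exp_t: "2 * exp (- t) = p / real K"
    using p assms(8) by (simp add: t_def exp_minus)
  have X_meas: "X i \<in> borel_measurable M" if "i \<in> {1..m}" for i
    using distributed_measurable[OF assms(6)[OF that]] by simp
  have "Ck 0 f"
    using assms(3) unfolding C0_infinity_def by blast
  then have "f \<in> borel_measurable borel"
    by (simp add: borel_measurable_continuous_onI)
  then have h_meas: "(\<lambda>z. h (fst z) (fst (snd z)) (snd (snd z)))
      \<in> borel_measurable (M \<Otimes>\<^sub>M (borel \<Otimes>\<^sub>M borel))"
    unfolding h_def
    by (intro borel_measurable_diff empirical_radon_measurable X_meas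
          measurable_compose[OF measurable_snd half_space_radon_measurable])
  have [measurable]: "(\<lambda>\<omega>. cylinder_L2_norm (h \<omega>)) \<in> borel_measurable M"
    by (rule cylinder_L2_norm_measurable[OF h_meas])

  define V where "V j \<omega> = (line_L2_norm (\<lambda>s. h \<omega> s (\<theta> j)))\<^sup>2" for j \<omega>
  have tail: "V j \<in> borel_measurable M"
    "prob {\<omega> \<in> space M. t / real m \<le> V j \<omega>} \<le> p / real K" if j: "j \<in> {1..K}" for j
  proof -
    define Y where "Y i \<omega> = X i \<omega> \<bullet> \<theta> j" for i \<omega>
    define F where "F s = half_space_radon f s (\<theta> j)" for s
    have fin: "finite {1..m}" and ne: "{1..m} \<noteq> {}"
      using assms(2) by auto
    have indep: "indep_vars (\<lambda>_. borel) Y {1..m}"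
      unfolding Y_def by (rule indep_vars_compose2[OF assms(7)]) measurable
    have range: "Y i \<omega> \<in> {-1..1}" if "i \<in> {1..m}" "\<omega> \<in> space M" for i \<omega>
    proof -
      have "\<bar>X i \<omega> \<bullet> \<theta> j\<bar> \<le> norm (X i \<omega>) * norm (\<theta> j)"
        by (rule Cauchy_Schwarz_ineq2)
      also have "\<dots> \<le> 1"
        using assms(5)[OF that] assms(9)[OF j] by simp
      finally show ?thesis
        by (simp add: Y_def abs_le_iff)
    qed
    have F: "prob {\<omega> \<in> space M. Y i \<omega> \<le> s} = F s" if "i \<in> {1..m}" for i s
      unfolding Y_def F_def using half_space_radon_eq_prob[OF assms(6)[OF that] assms(4)] by simp
    have V_eq: "V j = (\<lambda>\<omega>. LINT s|lborel.
        (F s - real (card {i\<in>{1..m}. Y i \<omega> \<le> s}) / real (card {1..m}))\<^sup>2)"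
      by (simp add: fun_eq_iff V_def line_L2_norm_power2 h_def F_def Y_def empirical_radon_def)
    \<comment> \<open>On \<open>{-1..1}\<close> the threshold \<open>(b - a) * t / (2 * m)\<close> is \<open>t / m\<close>.\<close>
    note * = prob_L2_dist_empirical_cdf_ge[OF fin ne indep range F _ t]
    show "V j \<in> borel_measurable M"
      using *(1) unfolding V_eq by simp
    show "prob {\<omega> \<in> space M. t / real m \<le> V j \<omega>} \<le> p / real K"
      using *(2) unfolding V_eq by (simp add: exp_t)
  qed
  have V_meas[measurable]: "\<And>j. j \<in> {1..K} \<Longrightarrow> V j \<in> borel_measurable M"
    by (rule tail)

  \<comment> \<open>\<open>G\<close> is the event of the claim and \<open>B j\<close> the event that the node \<open>\<theta> j\<close> is bad.\<close>
  define G where "G = {\<omega> \<in> space M. (cylinder_L2_norm (h \<omega>))\<^sup>2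
      \<le> A * (t / real m) + quadrature_error K w \<theta> (h \<omega>)}"
  define B where "B j = {\<omega> \<in> space M. t / real m \<le> V j \<omega>}" for j
  have quad: "quadrature_error K w \<theta> (h \<omega>)
      = \<bar>(cylinder_L2_norm (h \<omega>))\<^sup>2 - (\<Sum>j=1..K. w j * V j \<omega>)\<bar>" for \<omega>
    by (simp add: quadrature_error_def V_def)
  have B_sets: "B j \<in> events" if "j \<in> {1..K}" for j
    unfolding B_def using V_meas[OF that] by measurable
  have G_sets: "G \<in> events"
    unfolding G_def quad by measurable
  have "space M - (\<Union>j\<in>{1..K}. B j) \<subseteq> G"
  proof
    fix \<omega> assume \<omega>: "\<omega> \<in> space M - (\<Union>j\<in>{1..K}. B j)"
    have "(\<Sum>j=1..K. w j * V j \<omega>) \<le> (\<Sum>j=1..K. w j * (t / real m))"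
      using \<omega> by (intro sum_mono mult_left_mono assms(10)) (force simp: B_def)+
    also have "\<dots> = A * (t / real m)"
      by (simp only: A_def assms(11)[symmetric] sum_distrib_right)
    finally show "\<omega> \<in> G"
      using \<omega> by (simp add: G_def quad)
  qed
  then have "prob (space M - (\<Union>j\<in>{1..K}. B j)) \<le> prob G"
    by (intro finite_measure_mono G_sets)
  moreover have "prob (space M - (\<Union>j\<in>{1..K}. B j)) = 1 - prob (\<Union>j\<in>{1..K}. B j)"
    using B_sets by (intro prob_compl) auto
  moreover have "prob (\<Union>j\<in>{1..K}. B j) \<le> (\<Sum>j=1..K. prob (B j))"
    using B_sets by (intro finite_measure_subadditive_finite) auto
  moreover have "(\<Sum>j=1..K. prob (B j)) \<le> (\<Sum>j=1..K. p / real K)"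
    unfolding B_def by (intro sum_mono tail)
  moreover have "(\<Sum>j=1..K. p / real K) = p"
    using assms(8) by simp
  ultimately have "1 - p \<le> prob G"
    by linarith
  then show ?thesis
    using False by (simp add: G_def A_def t_def)
qed

end
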